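(* Let $m\in(1,+\infty)$, $s\in(0,1)$ and $N=1$. Let $u_0\in L^1(\mathbb{R})$, $u_0\ge 0$, with $\|u_0\|_{L^1(\mathbb{R})}=M$, let $u$ be the weak solution of $$\partial_t u=\nabla\cdot\big(u^{m-1}\nabla(-\Delta)^{-s}u\big)\quad\text{in }\mathbb{R}^N\times(0,\infty)$$ with initial data $u_0$, and for $\lambda>0$ put $u_\lambda(x,t)=\lambda^N u(\lambda x,\lambda^b t)$ with $b=(m-1)N+2-2s$. Let $U_M$ be the limit of $u_\lambda$ as $\lambda\to\infty$, in the sense that $u_\lambda\to U_M$ in $L^p(\mathbb{R}^N\times[t_1,t_2])$ for all $0<t_1<t_2<\infty$ and all $1\le p<\infty$ (this limit exists and is a weak solution of the same equation with initial data $M\delta_0$). Then $U_M$ is a self-similar solution of the form $$U_M(x,t)=t^{-\alpha}\phi(xt^{-\beta})$$ for a certain function $\phi:\mathbb{R}^N\to\mathbb{R}$, with $\alpha=N\beta$ and $\beta=\dfrac{1}{N(m-1)+2-2s}$.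
   Context: Here $N=1$, so $\nabla$ and $\nabla\cdot$ both mean $\partial_x$. $(-\Delta)^{\sigma}$ is the operator with Fourier symbol $|\xi|^{2\sigma}$, and $\nabla(-\Delta)^{-s}$ is the composed operator (symbol $i\xi|\xi|^{-2s}$). Weak solution: let $\mu$ be a nonnegative Radon measure on $\mathbb{R}^N$ of finite mass. A function $u\ge 0$ is a weak solution on $\mathbb{R}^N\times(0,T)$ with initial data $\mu$ if $u$, $\nabla(-\Delta)^{-s}u$ and $u^{m-1}\nabla(-\Delta)^{-s}u$ all belong to $L^1_{\mathrm{loc}}(\mathbb{R}^N\times(0,T))$ and $$\int_0^T\!\!\int_{\mathbb{R}^N}u\,\phi_t\,dx\,dt-\int_0^T\!\!\int_{\mathbb{R}^N}u^{m-1}\nabla(-\Delta)^{-s}u\cdot\nabla\phi\,dx\,dt+\int_{\mathbb{R}^N}\phi(x,0)\,d\mu(x)=0$$ for all $\phi\in C^1_c(\mathbb{R}^N\times[0,T))$. A weak solution for all times is a weak solution on $\mathbb{R}^N\times(0,T)$ for every $T>0$. If the initial data is a function $u_0\ge0$ in $L^1$, then $d\mu=u_0\,dx$. In dimension $N=1$ there is exactly one weak solution for each nonnegative Radon measure of finite mass as initial data. Functions are identified up to equality almost everywhere. *)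

theory Defs
  imports "HOL-Probability.Probability"
begin

text \<open>
  Functions on space-time \<open>\<real> \<times> (0, T)\<close> have type \<open>real \<times> real \<Rightarrow> real\<close>, the arguments being
  position and time; their values outside the time interval under consideration play no role.
  Functions are identified up to equality almost everywhere; every class has a Borel
  representative, so we work with \<^term>\<open>lborel\<close>.
\<close>

definition L1_loc :: "'a::euclidean_space set \<Rightarrow> ('a \<Rightarrow> real) \<Rightarrow> bool" where
  "L1_loc S f \<longleftrightarrow> (\<forall>K. compact K \<and> K \<subseteq> S \<longrightarrow> set_integrable lborel K f)"

definition in_Lp :: "real \<Rightarrow> 'a::euclidean_space set \<Rightarrow> ('a \<Rightarrow> real) \<Rightarrow> bool" where
  "in_Lp p S f \<longleftrightarrow>
     set_borel_measurable lborel S f \<and> set_integrable lborel S (\<lambda>z. \<bar>f z\<bar> powr p)"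

definition Lp_norm :: "real \<Rightarrow> 'a::euclidean_space set \<Rightarrow> ('a \<Rightarrow> real) \<Rightarrow> real" where
  "Lp_norm p S f = (LINT z:S|lborel. \<bar>f z\<bar> powr p) powr (1 / p)"

definition tendsto_Lp ::
  "real \<Rightarrow> 'a::euclidean_space set \<Rightarrow> ('i \<Rightarrow> 'a \<Rightarrow> real) \<Rightarrow> ('a \<Rightarrow> real) \<Rightarrow> 'i filter \<Rightarrow> bool" where
  "tendsto_Lp p S F f A \<longleftrightarrow>
     (\<forall>\<^sub>F i in A. in_Lp p S (F i)) \<and> in_Lp p S f \<and>
     ((\<lambda>i. Lp_norm p S (\<lambda>z. F i z - f z)) \<longlongrightarrow> 0) A"

definition fourier :: "(real \<Rightarrow> real) \<Rightarrow> real \<Rightarrow> complex" where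
  "fourier f \<xi> = (LINT x|lborel. complex_of_real (f x) * cis (- (x * \<xi>)))"

text \<open>
  The operator with symbol \<open>\<sigma>\<close>, for test functions. It is only used for symbols with
  \<open>\<sigma> (-\<xi>) = cnj (\<sigma> \<xi>)\<close>; the value is then real and \<^const>\<open>Re\<close> is a mere change of type.
\<close>
definition fourier_multiplier :: "(real \<Rightarrow> complex) \<Rightarrow> (real \<Rightarrow> real) \<Rightarrow> real \<Rightarrow> real" where
  "fourier_multiplier \<sigma> f x =
     Re ((LINT \<xi>|lborel. \<sigma> \<xi> * fourier f \<xi> * cis (x * \<xi>)) / complex_of_real (2 * pi))"

definition grad_frac_symbol :: "real \<Rightarrow> real \<Rightarrow> complex" where
  "grad_frac_symbol s \<xi> = \<i> * complex_of_real (\<xi> * \<bar>\<xi>\<bar> powr (- 2 * s))"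

definition smooth_compact_support :: "(real \<Rightarrow> real) \<Rightarrow> bool" where
  "smooth_compact_support \<psi> \<longleftrightarrow>
     (\<forall>n x. (deriv ^^ n) \<psi> field_differentiable at x) \<and>
     (\<exists>K. compact K \<and> (\<forall>x. x \<notin> K \<longrightarrow> \<psi> x = 0))"

text \<open>
  \<open>g = \<nabla>(-\<Delta>)\<^sup>-\<^sup>s v\<close> in the sense of distributions: the transpose of the multiplier with symbol
  \<open>\<sigma> \<xi>\<close> is the multiplier with symbol \<open>\<sigma> (-\<xi>)\<close>. For \<open>0 < s < 1\<close> the symbol is locally integrable,
  so the multiplier maps test functions to bounded continuous functions, and the pairing with
  \<open>v\<close> makes sense in particular for all \<open>v \<in> L\<^sup>1\<close>.
\<close>
definition is_grad_frac :: "real \<Rightarrow> (real \<Rightarrow> real) \<Rightarrow> (real \<Rightarrow> real) \<Rightarrow> bool" where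
  "is_grad_frac s v g \<longleftrightarrow>
     (\<forall>\<psi>. smooth_compact_support \<psi> \<longrightarrow>
        (let \<psi>' = fourier_multiplier (\<lambda>\<xi>. grad_frac_symbol s (- \<xi>)) \<psi>
         in integrable lborel (\<lambda>x. v x * \<psi>' x) \<and>
            integrable lborel (\<lambda>x. g x * \<psi> x) \<and>
            (LINT x|lborel. g x * \<psi> x) = (LINT x|lborel. v x * \<psi>' x)))"

text \<open>
  \<open>\<phi> \<in> C\<^sup>1\<^sub>c(\<real> \<times> [0, T))\<close> with partial derivatives \<open>\<phi>x\<close> and \<open>\<phi>t\<close>. The derivatives are one-sided in
  time at \<open>t = 0\<close>, and \<open>\<phi>\<close> need not vanish there.
\<close>
definition C1_test_function ::
  "real \<Rightarrow> (real \<times> real \<Rightarrow> real) \<Rightarrow> (real \<times> real \<Rightarrow> real) \<Rightarrow> (real \<times> real \<Rightarrow> real) \<Rightarrow> bool" where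
  "C1_test_function T \<phi> \<phi>x \<phi>t \<longleftrightarrow>
     (let S = UNIV \<times> {0..<T}
      in (\<forall>z\<in>S. (\<phi> has_derivative (\<lambda>(h, k). \<phi>x z * h + \<phi>t z * k)) (at z within S)) \<and>
         continuous_on S \<phi>x \<and> continuous_on S \<phi>t \<and>
         (\<exists>K. compact K \<and> K \<subseteq> S \<and> (\<forall>z\<in>S - K. \<phi> z = 0)))"

text \<open>
  A finite Borel measure on \<open>\<real>\<close> is automatically a Radon measure. Integrability of the two
  space-time integrands is demanded explicitly: local integrability on the open strip does not
  control them near \<open>t = 0\<close>, and \<^const>\<open>lebesgue_integral\<close> is zero by convention for functions
  that are not integrable.
\<close>
definition weak_solution_on ::
  "real \<Rightarrow> real \<Rightarrow> real \<Rightarrow> real measure \<Rightarrow> (real \<times> real \<Rightarrow> real) \<Rightarrow> bool" where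
  "weak_solution_on m s T \<mu> u \<longleftrightarrow>
     finite_measure \<mu> \<and> sets \<mu> = sets borel \<and>
     (AE (x, t) in lborel. 0 < t \<and> t < T \<longrightarrow> 0 \<le> u (x, t)) \<and>
     (\<exists>g. (AE t in lborel. 0 < t \<and> t < T \<longrightarrow> is_grad_frac s (\<lambda>x. u (x, t)) (\<lambda>x. g (x, t))) \<and>
          L1_loc (UNIV \<times> {0<..<T}) u \<and>
          L1_loc (UNIV \<times> {0<..<T}) g \<and>
          L1_loc (UNIV \<times> {0<..<T}) (\<lambda>z. u z powr (m - 1) * g z) \<and>
          (\<forall>\<phi> \<phi>x \<phi>t. C1_test_function T \<phi> \<phi>x \<phi>t \<longrightarrow>
             set_integrable lborel (UNIV \<times> {0<..<T}) (\<lambda>z. u z * \<phi>t z) \<and>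
             set_integrable lborel (UNIV \<times> {0<..<T}) (\<lambda>z. u z powr (m - 1) * g z * \<phi>x z) \<and>
             (LINT z:UNIV \<times> {0<..<T}|lborel. u z * \<phi>t z)
               - (LINT z:UNIV \<times> {0<..<T}|lborel. u z powr (m - 1) * g z * \<phi>x z)
               + (LINT x|\<mu>. \<phi> (x, 0)) = 0))"

definition weak_solution ::
  "real \<Rightarrow> real \<Rightarrow> real measure \<Rightarrow> (real \<times> real \<Rightarrow> real) \<Rightarrow> bool" where
  "weak_solution m s \<mu> u \<longleftrightarrow> (\<forall>T>0. weak_solution_on m s T \<mu> u)"

definition rescale :: "real \<Rightarrow> (real \<times> real \<Rightarrow> real) \<Rightarrow> real \<Rightarrow> real \<times> real \<Rightarrow> real" where
  "rescale b u l = (\<lambda>(x, t). l * u (l * x, l powr b * t))"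

end

theory Submission imports Defs begin

text \<open>
  Rescaling by \<open>l\<close> and then by \<open>k\<close> is rescaling by \<open>l * k\<close>, so the limit \<open>U\<close> of the rescaled family
  equals \<open>k U(k x, k\<^sup>b t)\<close> almost everywhere, for each \<open>k > 0\<close>. The exceptional set depends on \<open>k\<close>;
  by Fubini and the substitution \<open>k = (\<tau> / t)\<^sup>\<beta>\<close> a single time \<open>\<tau> > 0\<close> can be chosen with
  \<open>U(x, t) = (\<tau> / t)\<^sup>\<beta> U(x (\<tau> / t)\<^sup>\<beta>, \<tau>)\<close> for almost all \<open>(x, t)\<close>, so the profile
  is read off from the slice of \<open>U\<close> at time \<open>\<tau>\<close>.
\<close>

section \<open>Rescaling, change of variables and convergence in L^1\<close>

lemma rescale_rescale:
  assumes "0 < k" "0 < l"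
  shows "rescale b (rescale b u l) k = rescale b u (l * k)"
  using assms by (auto simp: rescale_def fun_eq_iff powr_mult mult_ac)

lemma nn_integral_lborel_scale_prod:
  fixes f :: "real \<times> real \<Rightarrow> ennreal"
  assumes [measurable]: "f \<in> borel_measurable borel" and "0 < a" "0 < c"
  shows "(\<integral>\<^sup>+z. f z \<partial>lborel) = ennreal (a * c) * (\<integral>\<^sup>+(x, t). f (a * x, c * t) \<partial>lborel)"
proof -
  have f': "f \<in> borel_measurable (lborel \<Otimes>\<^sub>M lborel)"
    by (simp add: lborel_prod)
  have [measurable]: "f \<in> borel_measurable (borel \<Otimes>\<^sub>M borel)"
    by (simp add: borel_prod)
  have "(\<integral>\<^sup>+z. f z \<partial>lborel) = (\<integral>\<^sup>+x. \<integral>\<^sup>+t. f (x, t) \<partial>lborel \<partial>lborel)"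
    using lborel.nn_integral_fst[OF f'] by (simp add: lborel_prod)
  also have "\<dots> = (\<integral>\<^sup>+x. ennreal c * (\<integral>\<^sup>+t. f (x, c * t) \<partial>lborel) \<partial>lborel)"
    using \<open>0 < c\<close> by (intro nn_integral_cong, subst nn_integral_real_affine[where c=c and t=0]) auto
  also have "\<dots> = ennreal a * (\<integral>\<^sup>+x. ennreal c * (\<integral>\<^sup>+t. f (a * x, c * t) \<partial>lborel) \<partial>lborel)"
    using \<open>0 < a\<close> by (subst nn_integral_real_affine[where c=a and t=0]) auto
  also have "\<dots> = ennreal (a * c) * (\<integral>\<^sup>+x. \<integral>\<^sup>+t. f (a * x, c * t) \<partial>lborel \<partial>lborel)"
    using \<open>0 < a\<close> \<open>0 < c\<close> by (subst nn_integral_cmult) (auto simp: ennreal_mult mult_ac)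
  also have "(\<integral>\<^sup>+x. \<integral>\<^sup>+t. f (a * x, c * t) \<partial>lborel \<partial>lborel) = (\<integral>\<^sup>+(x, t). f (a * x, c * t) \<partial>lborel)"
    using lborel.nn_integral_fst[of "\<lambda>(x, t). f (a * x, c * t)" lborel]
    by (simp add: lborel_prod borel_prod[symmetric])
  finally show ?thesis .
qed

text \<open>With \<open>nn_integral\<close> in place of \<open>Lp_norm\<close>, the triangle
  inequality needs only measurability of the pieces. That holds for the difference cut off to
  \<open>S\<close>, and only eventually, because \<open>tendsto_Lp\<close> controls
  \<open>F i\<close> only on \<open>S\<close> and only for eventually all \<open>i\<close>.\<close>

lemma tendsto_L1_nn_integral:
  assumes "tendsto_Lp 1 S F f A"
  shows "\<forall>\<^sub>F i in A. (\<lambda>z. indicator S z * (F i z - f z)) \<in> borel_measurable borel"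
    and "((\<lambda>i. \<integral>\<^sup>+z. ennreal \<bar>indicator S z * (F i z - f z)\<bar> \<partial>lborel) \<longlongrightarrow> 0) A"
proof -
  have F: "\<forall>\<^sub>F i in A. in_Lp 1 S (F i)" and f: "in_Lp 1 S f"
    and lim: "((\<lambda>i. Lp_norm 1 S (\<lambda>z. F i z - f z)) \<longlongrightarrow> 0) A"
    using assms by (auto simp: tendsto_Lp_def)
  \<comment> \<open>Membership in L^1 speaks of |g|; the separate measurability of \<open>g\<close>
    on \<open>S\<close> lets the absolute value be dropped.\<close>
  have int: "integrable lborel (\<lambda>z. indicator S z * g z)" if "in_Lp 1 S g" for g
  proof -
    have "integrable lborel (\<lambda>z. indicator S z * \<bar>g z\<bar>)"
      and "(\<lambda>z. indicator S z * g z) \<in> borel_measurable lborel"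
      using that by (simp_all add: in_Lp_def set_integrable_def set_borel_measurable_def)
    then show ?thesis
      by (rule Bochner_Integration.integrable_bound) (simp add: abs_mult)
  qed
  have diff: "integrable lborel (\<lambda>z. indicator S z * (F i z - f z))" if "in_Lp 1 S (F i)" for i
    using Bochner_Integration.integrable_diff[OF int[OF that] int[OF f]]
    by (simp add: right_diff_distrib)
  show "\<forall>\<^sub>F i in A. (\<lambda>z. indicator S z * (F i z - f z)) \<in> borel_measurable borel"
    using F by eventually_elim (use diff borel_measurable_integrable in fastforce)
  have "\<forall>\<^sub>F i in A. ennreal (Lp_norm 1 S (\<lambda>z. F i z - f z)) =
      (\<integral>\<^sup>+z. ennreal \<bar>indicator S z * (F i z - f z)\<bar> \<partial>lborel)"
    using F
  proof eventually_elim
    case (elim i)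
    have "Lp_norm 1 S (\<lambda>z. F i z - f z) = (LINT z|lborel. \<bar>indicator S z * (F i z - f z)\<bar>)"
      by (simp add: Lp_norm_def set_lebesgue_integral_def abs_mult)
    then show ?case
      using diff[OF elim] by (simp add: nn_integral_eq_integral)
  qed
  moreover have "((\<lambda>i. ennreal (Lp_norm 1 S (\<lambda>z. F i z - f z))) \<longlongrightarrow> 0) A"
    using tendsto_ennrealI[OF lim] by simp
  ultimately show "((\<lambda>i. \<integral>\<^sup>+z. ennreal \<bar>indicator S z * (F i z - f z)\<bar> \<partial>lborel) \<longlongrightarrow> 0) A"
    by (rule Lim_transform_eventually[rotated])
qed

section \<open>Scaling invariance of the limit\<close>

text \<open>As \<open>l\<close> grows, \<open>rescale b u (l * k)\<close> tends to \<open>U\<close>.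
  It is also the rescaling by \<open>k\<close> of \<open>rescale b u l\<close>, and since rescaling
  is bounded on L^1 it tends to \<open>rescale b U k\<close>. Limits in L^1 are unique almost
  everywhere.\<close>

lemma rescale_limit_invariant_strip:
  assumes lim: "\<And>t1 t2. 0 < t1 \<Longrightarrow> t1 < t2 \<Longrightarrow>
      tendsto_Lp 1 (UNIV \<times> {t1..t2}) (\<lambda>l. rescale b u l) U at_top"
    and "0 < k" "0 < t1" "t1 < t2"
  shows "AE z in lborel. z \<in> UNIV \<times> {t1..t2} \<longrightarrow> U z = rescale b U k z"
proof -
  define S where "S = (UNIV :: real set) \<times> {t1..t2}"
  \<comment> \<open>\<open>S'\<close> is the image of the strip \<open>S\<close> under (x, t) -> (k
    x, k^b t), so a cutoff to \<open>S'\<close> becomes a cutoff to \<open>S\<close> after rescaling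
    by \<open>k\<close>.\<close>
  define S' where "S' = (UNIV :: real set) \<times> {k powr b * t1..k powr b * t2}"
  define D where "D = (\<lambda>l z. indicator S z * (rescale b u l z - U z))"
  define D' where "D' = (\<lambda>l z. indicator S' z * (rescale b u l z - U z))"
  define E where "E = (\<lambda>z. indicator S z * (U z - rescale b U k z))"
  have kb: "0 < k powr b" using \<open>0 < k\<close> by simp
  have limS: "tendsto_Lp 1 S (\<lambda>l. rescale b u l) U at_top"
    and limS': "tendsto_Lp 1 S' (\<lambda>l. rescale b u l) U at_top"
    unfolding S_def S'_def using assms kb by (auto intro!: lim)
  have lk: "filterlim (\<lambda>l. l * k) at_top at_top"
    using \<open>0 < k\<close> by (simp add: filterlim_at_top_mult_tendsto_pos[OF tendsto_const _ filterlim_ident])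
  have mD: "\<forall>\<^sub>F l in at_top. D (l * k) \<in> borel_measurable borel"
    using eventually_compose_filterlim[OF tendsto_L1_nn_integral(1)[OF limS] lk] by (simp add: D_def)
  have mD': "\<forall>\<^sub>F l in at_top. D' l \<in> borel_measurable borel"
    using tendsto_L1_nn_integral(1)[OF limS'] by (simp add: D'_def)
  have tD: "((\<lambda>l. \<integral>\<^sup>+z. ennreal \<bar>D (l * k) z\<bar> \<partial>lborel) \<longlongrightarrow> 0) at_top"
    using filterlim_compose[OF tendsto_L1_nn_integral(2)[OF limS] lk] by (simp add: D_def)
  have tD': "((\<lambda>l. \<integral>\<^sup>+z. ennreal \<bar>D' l z\<bar> \<partial>lborel) \<longlongrightarrow> 0) at_top"
    using tendsto_L1_nn_integral(2)[OF limS'] by (simp add: D'_def)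
  \<comment> \<open>The factor by which rescaling by \<open>k\<close> changes the L^1 norm: the
    prefactor \<open>k\<close> divided by the Jacobian \<open>k * k powr b\<close>.\<close>
  define C where "C = ennreal (k / (k * k powr b))"
  \<comment> \<open>Both terms on the right contain \<open>rescale b u (l * k)\<close>, cut off to
    \<open>S\<close>; it cancels, so the left side does not depend on \<open>l\<close>.\<close>
  have split: "E z = rescale b (D' l) k z - D (l * k) z" if "0 < l" for l z
  proof -
    have at: "rescale b f k z = k * f (k * fst z, k powr b * snd z)" for f
      by (simp add: rescale_def case_prod_beta)
    have "indicator S' (k * fst z, k powr b * snd z) = (indicator S z :: real)"
      using kb by (cases z) (simp add: S_def S'_def indicator_def)
    moreover have "rescale b u (l * k) z = k * rescale b u l (k * fst z, k powr b * snd z)"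
      using that \<open>0 < k\<close> by (simp add: at flip: rescale_rescale)
    ultimately show ?thesis
      unfolding E_def D_def D'_def at by (simp add: algebra_simps)
  qed
  have bound: "\<forall>\<^sub>F l in at_top. (\<integral>\<^sup>+z. ennreal \<bar>E z\<bar> \<partial>lborel)
      \<le> C * (\<integral>\<^sup>+z. ennreal \<bar>D' l z\<bar> \<partial>lborel) + (\<integral>\<^sup>+z. ennreal \<bar>D (l * k) z\<bar> \<partial>lborel)"
    using mD mD' eventually_gt_at_top[of 0]
  proof eventually_elim
    case (elim l)
    note [measurable] = elim(1,2)
    have [measurable]: "D' l \<in> borel_measurable (borel \<Otimes>\<^sub>M borel)"
      using elim(2) by (simp add: borel_prod)
    have [measurable]: "rescale b (D' l) k \<in> borel_measurable borel"
      unfolding rescale_def borel_prod[symmetric] by measurable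
    have "(\<integral>\<^sup>+z. ennreal \<bar>E z\<bar> \<partial>lborel)
        \<le> (\<integral>\<^sup>+z. ennreal \<bar>rescale b (D' l) k z\<bar> + ennreal \<bar>D (l * k) z\<bar> \<partial>lborel)"
      using elim(3)
      by (intro nn_integral_mono) (simp add: split[of l] flip: ennreal_plus)
    also have "\<dots> = (\<integral>\<^sup>+z. ennreal \<bar>rescale b (D' l) k z\<bar> \<partial>lborel)
        + (\<integral>\<^sup>+z. ennreal \<bar>D (l * k) z\<bar> \<partial>lborel)"
      by (intro nn_integral_add) measurable
    also have "(\<integral>\<^sup>+z. ennreal \<bar>rescale b (D' l) k z\<bar> \<partial>lborel) = C * (\<integral>\<^sup>+z. ennreal \<bar>D' l z\<bar> \<partial>lborel)"
    proof -
      have m: "(\<lambda>z. ennreal \<bar>D' l z\<bar>) \<in> borel_measurable borel" by measurable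
      have "C * (\<integral>\<^sup>+z. ennreal \<bar>D' l z\<bar> \<partial>lborel)
          = ennreal k * (\<integral>\<^sup>+(x, t). ennreal \<bar>D' l (k * x, k powr b * t)\<bar> \<partial>lborel)"
        unfolding nn_integral_lborel_scale_prod[OF m \<open>0 < k\<close> kb] C_def
        using \<open>0 < k\<close> kb by (simp add: mult.assoc[symmetric] ennreal_mult[symmetric])
      also have "\<dots> = (\<integral>\<^sup>+(x, t). ennreal k * ennreal \<bar>D' l (k * x, k powr b * t)\<bar> \<partial>lborel)"
        unfolding case_prod_beta
        by (intro nn_integral_cmult[symmetric]) (simp add: borel_prod[symmetric])
      also have "\<dots> = (\<integral>\<^sup>+z. ennreal \<bar>rescale b (D' l) k z\<bar> \<partial>lborel)"
        using \<open>0 < k\<close> by (intro nn_integral_cong)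
          (simp add: rescale_def case_prod_beta abs_mult ennreal_mult)
      finally show ?thesis ..
    qed
    finally show ?case .
  qed
  have "((\<lambda>l. C * (\<integral>\<^sup>+z. ennreal \<bar>D' l z\<bar> \<partial>lborel) + (\<integral>\<^sup>+z. ennreal \<bar>D (l * k) z\<bar> \<partial>lborel)) \<longlongrightarrow> C * 0 + 0) at_top"
    by (intro tendsto_add ennreal_tendsto_cmult tD tD') (simp add: C_def)
  \<comment> \<open>The constant left side lies eventually below a quantity that tends to 0.\<close>
  then have "(\<integral>\<^sup>+z. ennreal \<bar>E z\<bar> \<partial>lborel) \<le> C * 0 + 0"
    using bound by (intro tendsto_lowerbound[of _ _ at_top]) auto
  then have "(\<integral>\<^sup>+z. ennreal \<bar>E z\<bar> \<partial>lborel) = 0" by simp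
  \<comment> \<open>The values of \<open>U\<close> off the strips are arbitrary, so measurability of
    \<open>E\<close> is read off from \<open>split\<close> at one sufficiently large
    \<open>l\<close>.\<close>
  moreover have "E \<in> borel_measurable borel"
  proof -
    obtain l where "0 < l" and [measurable]: "D (l * k) \<in> borel_measurable borel"
        "D' l \<in> borel_measurable borel"
      using eventually_happens[OF eventually_conj[OF eventually_gt_at_top[of "0::real"] eventually_conj[OF mD mD']]]
      by auto
    have [measurable]: "D' l \<in> borel_measurable (borel \<Otimes>\<^sub>M borel)"
      by (simp add: borel_prod)
    have [measurable]: "rescale b (D' l) k \<in> borel_measurable borel"
      unfolding rescale_def borel_prod[symmetric] by measurable
    have "E = (\<lambda>z. rescale b (D' l) k z - D (l * k) z)"
      using split[OF \<open>0 < l\<close>] by blast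
    then show ?thesis by simp
  qed
  ultimately have "AE z in lborel. E z = 0"
    by (subst (asm) nn_integral_0_iff_AE) auto
  then show ?thesis
    by eventually_elim (auto simp: E_def S_def)
qed

section \<open>From scaling invariance to a self-similar profile\<close>

text \<open>The map k -> c k^b is differentiable on the positive half-line, hence sends null sets to
  null sets, and it reaches every positive \<tau>. Since \<open>P\<close> may be non-measurable, the
  exceptional sets are treated as \<open>negligible\<close> sets.\<close>

lemma AE_lborel_substitute_powr:
  fixes c b :: real
  assumes "0 < c" "0 < b"
    and P: "AE k in lborel. 0 < k \<longrightarrow> P (c * k powr b)"
  shows "AE \<tau> in lborel. 0 < \<tau> \<longrightarrow> P \<tau>"
proof -
  define N where "N = {k. 0 < k \<and> \<not> P (c * k powr b)}"
  have "negligible N"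
    using P by (simp add: negligible_iff_null_sets eventually_ae_filter null_sets_completion_iff2 N_def)
  moreover have "(\<lambda>k. c * k powr b) differentiable_on N"
  proof (unfold differentiable_on_def, rule ballI, rule differentiable_at_withinI)
    fix k assume "k \<in> N"
    then have "((\<lambda>k. c * k powr b) has_real_derivative c * (b * k powr (b - 1))) (at k)"
      using DERIV_cmult[OF has_real_derivative_powr[of k b], of c] by (simp add: N_def)
    then show "(\<lambda>k. c * k powr b) differentiable (at k)"
      unfolding real_differentiable_def by blast
  qed
  ultimately have "negligible ((\<lambda>k. c * k powr b) ` N)"
    by (rule negligible_differentiable_image_negligible[rotated]) simp
  moreover have "{\<tau>. 0 < \<tau> \<and> \<not> P \<tau>} \<subseteq> (\<lambda>k. c * k powr b) ` N"
  proof
    fix \<tau> assume "\<tau> \<in> {\<tau>. 0 < \<tau> \<and> \<not> P \<tau>}"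
    then have "c * ((\<tau> / c) powr (1 / b)) powr b = \<tau>" "0 < \<tau>" "\<not> P \<tau>"
      using assms by (auto simp: powr_powr)
    then show "\<tau> \<in> (\<lambda>k. c * k powr b) ` N"
      using \<open>0 < c\<close> by (intro image_eqI[of _ _ "(\<tau> / c) powr (1 / b)"]) (auto simp: N_def)
  qed
  ultimately have "negligible {\<tau>. 0 < \<tau> \<and> \<not> P \<tau>}"
    by (rule negligible_subset)
  then show ?thesis
    by (simp add: negligible_iff_null_sets eventually_ae_filter null_sets_completion_iff2)
qed

lemma AE_scaling_invariant_imp_self_similar:
  fixes V :: "real \<times> real \<Rightarrow> real"
  assumes V: "V \<in> borel_measurable borel" and "0 < b"
    and inv: "\<And>k. 0 < k \<Longrightarrow>
      AE (x, t) in lborel. 0 < t \<longrightarrow> V (x, t) = k * V (k * x, k powr b * t)"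
  shows "\<exists>\<phi>. AE (x, t) in lborel. 0 < t \<longrightarrow>
      V (x, t) = t powr (- (1 / b)) * \<phi> (x * t powr (- (1 / b)))"
proof -
  have [measurable]: "V \<in> borel_measurable (borel \<Otimes>\<^sub>M borel)"
    using V by (simp add: borel_prod)
  \<comment> \<open>\<open>P\<close> is the invariance with parameter \<open>k\<close>;
    \<open>Q\<close> is the same relation in the parameter \<tau> = k^b t, the time at which the
    right side evaluates \<open>V\<close>.\<close>
  define P where "P = (\<lambda>k z. 0 < k \<longrightarrow> 0 < snd z \<longrightarrow> V z = k * V (k * fst z, k powr b * snd z))"
  define Q where "Q = (\<lambda>\<tau> z. 0 < \<tau> \<longrightarrow> 0 < snd z \<longrightarrow>
      V z = (\<tau> / snd z) powr (1 / b) * V ((\<tau> / snd z) powr (1 / b) * fst z, \<tau>))"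
  have "AE k in lborel. AE z in lborel. P k z"
  proof (rule AE_I2)
    show "AE z in lborel. P k z" for k
      using inv[of k] by (cases "0 < k") (simp_all add: P_def case_prod_beta)
  qed
  \<comment> \<open>Exchanging the two almost-everywhere quantifiers is Fubini and needs a
    measurable set; here Borel measurability of \<open>V\<close> enters.\<close>
  moreover have "{x \<in> space (lborel \<Otimes>\<^sub>M lborel). P (fst x) (snd x)} \<in> sets (lborel \<Otimes>\<^sub>M lborel)"
    unfolding P_def lborel_prod[symmetric, where ?'a = real and ?'b = real] by measurable
  ultimately have "AE z in lborel. AE k in lborel. P k z"
    using lborel_pair.AE_commute[of P] by blast
  then have "AE z in lborel. AE \<tau> in lborel. Q \<tau> z"
  proof eventually_elim
    case (elim z)
    show ?case
    proof (cases "0 < snd z")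
      case True
      \<comment> \<open>For \<tau> = t k^b the factor (\<tau> / t)^(1/b) equals \<open>k\<close>,
        which turns \<open>Q\<close> into \<open>P\<close>.\<close>
      have "AE k in lborel. 0 < k \<longrightarrow> Q (snd z * k powr b) z"
        using elim
      proof eventually_elim
        case (elim k)
        then show ?case
          using True \<open>0 < b\<close> by (auto simp: P_def Q_def powr_powr mult.commute)
      qed
      from AE_lborel_substitute_powr[OF True \<open>0 < b\<close> this] show ?thesis
        by eventually_elim (simp add: Q_def)
    qed (simp add: Q_def)
  qed
  moreover have "{x \<in> space (lborel \<Otimes>\<^sub>M lborel). Q (fst x) (snd x)} \<in> sets (lborel \<Otimes>\<^sub>M lborel)"
    unfolding Q_def lborel_prod[symmetric, where ?'a = real and ?'b = real] by measurable
  ultimately have Q: "AE \<tau> in lborel. AE z in lborel. Q \<tau> z"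
    using lborel_pair.AE_commute[of Q] by blast
  \<comment> \<open>The positive times do not form a null set, so a property of almost every \<tau>
    holds for at least one \<tau> > 0.\<close>
  have "\<not> (AE \<tau> in lborel. \<tau> \<le> (0::real))"
  proof
    assume "AE \<tau> in lborel. \<tau> \<le> (0::real)"
    then have "AE \<tau> in lborel. \<tau> \<notin> {0<..<1::real}"
      by eventually_elim simp
    then have "emeasure lborel {0<..<1::real} = 0"
      using AE_iff_measurable[of "{0<..<1::real}" lborel "\<lambda>\<tau>. \<tau> \<notin> {0<..<1}"]
      by (simp add: greaterThanLessThan_eq greaterThan_def lessThan_def Int_def)
    then show False by simp
  qed
  then obtain \<tau> where "0 < \<tau>" and \<tau>: "AE z in lborel. Q \<tau> z"
    using Q by (metis (mono_tags, lifting) eventually_mono not_le)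
  \<comment> \<open>Since (\<tau> / t)^(1/b) = \<tau>^(1/b) t^(-1/b), the profile absorbs the powers
    of the fixed \<tau> and leaves those of t.\<close>
  define \<phi> where "\<phi> = (\<lambda>y. \<tau> powr (1 / b) * V (\<tau> powr (1 / b) * y, \<tau>))"
  have "AE (x, t) in lborel. 0 < t \<longrightarrow>
      V (x, t) = t powr (- (1 / b)) * \<phi> (x * t powr (- (1 / b)))"
    using \<tau>
  proof eventually_elim
    case (elim z)
    then show ?case
      using \<open>0 < \<tau>\<close>
      by (auto simp: Q_def case_prod_beta \<phi>_def powr_divide powr_minus_divide mult_ac)
  qed
  then show ?thesis by blast
qed

section \<open>Passage from strips to the half-plane\<close>

lemma borel_measurable_from_strips:
  fixes U :: "real \<times> real \<Rightarrow> real"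
  assumes "\<And>t1 t2. 0 < t1 \<Longrightarrow> t1 < t2 \<Longrightarrow> set_borel_measurable lborel (UNIV \<times> {t1..t2}) U"
  shows "(\<lambda>z. indicator (UNIV \<times> {0<..}) z * U z) \<in> borel_measurable borel"
proof (rule borel_measurable_LIMSEQ_real)
  \<comment> \<open>These strips exhaust the half-plane t > 0, and at each point the cutoffs are
    eventually constant. The offset 2 makes the time interval nondegenerate already at n = 0, where
    offset 1 would give a single point.\<close>
  define S where "S = (\<lambda>n. (UNIV :: real set) \<times> {1 / (real n + 2)..real n + 2})"
  show "(\<lambda>z. indicator (S n) z * U z) \<in> borel_measurable borel" for n
  proof -
    have "1 / (real n + 2) < real n + 2"
      by (simp add: divide_less_eq algebra_simps add_pos_nonneg)
    then show ?thesis
      using assms[of "1 / (real n + 2)" "real n + 2"] by (simp add: S_def set_borel_measurable_def)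
  qed
  show "(\<lambda>n. indicator (S n) z * U z) \<longlonglongrightarrow> indicator (UNIV \<times> {0<..}) z * U z" for z
  proof (rule tendsto_eventually, cases "0 < snd z")
    case True
    have "\<forall>\<^sub>F n in sequentially. 1 / snd z \<le> real n \<and> snd z \<le> real n"
      using filterlim_real_sequentially by (auto simp: filterlim_at_top intro: eventually_conj)
    then show "\<forall>\<^sub>F n in sequentially. indicator (S n) z * U z = indicator (UNIV \<times> {0<..}) z * U z"
    proof eventually_elim
      case (elim n)
      then have "1 / (real n + 2) \<le> snd z"
        using True by (simp add: field_simps)
      with elim True show ?case
        by (cases z) (simp add: S_def indicator_def)
    qed
  next
    case False
    then have "snd z < 1 / (real n + 2)" for n
      by (smt (verit) of_nat_0_le_iff zero_less_divide_1_iff)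
    then show "\<forall>\<^sub>F n in sequentially. indicator (S n) z * U z = indicator (UNIV \<times> {0<..}) z * U z"
      using False by (cases z) (auto simp: S_def indicator_def not_le)
  qed
qed

text \<open>Countably many strips cover the half-plane t > 0, so the union of their exceptional null
  sets is still null.\<close>

lemma rescale_limit_invariant:
  assumes lim: "\<And>t1 t2. 0 < t1 \<Longrightarrow> t1 < t2 \<Longrightarrow>
      tendsto_Lp 1 (UNIV \<times> {t1..t2}) (\<lambda>l. rescale b u l) U at_top"
    and "0 < k"
  shows "AE (x, t) in lborel. 0 < t \<longrightarrow> U (x, t) = k * U (k * x, k powr b * t)"
proof -
  have "AE z in lborel. \<forall>n::nat. z \<in> UNIV \<times> {1 / (real n + 2)..real n + 2} \<longrightarrow> U z = rescale b U k z"
  proof (subst AE_all_countable, intro allI rescale_limit_invariant_strip[OF lim \<open>0 < k\<close>])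
    show "1 / (real n + 2) < real n + 2" for n
      by (simp add: divide_less_eq algebra_simps add_pos_nonneg)
  qed auto
  then show ?thesis
  proof eventually_elim
    case (elim z)
    show ?case
    proof (cases z)
      case (Pair x t)
      have "U (x, t) = k * U (k * x, k powr b * t)" if "0 < t"
      proof -
        obtain n :: nat where "max (1 / t) t \<le> real n"
          using real_arch_simple by blast
        then have "1 / t \<le> real n" "t \<le> real n" by auto
        then have "1 / (real n + 2) \<le> t"
          using that by (simp add: field_simps)
        with elim \<open>t \<le> real n\<close> Pair show ?thesis
          by (auto simp: rescale_def dest!: spec[of _ n])
      qed
      with Pair show ?thesis by simp
    qed
  qed
qed

theorem lemma6p5:
  fixes m s M b \<alpha> \<beta> :: real
    and u0 :: "real \<Rightarrow> real"
    and u U :: "real \<times> real \<Rightarrow> real"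
  assumes "1 < m" and "0 < s" and "s < 1"
    and "integrable lborel u0" and "AE x in lborel. 0 \<le> u0 x"
    and "(LINT x|lborel. \<bar>u0 x\<bar>) = M"
    and "weak_solution m s (density lborel (\<lambda>x. ennreal (u0 x))) u"
    and "b = (m - 1) + 2 - 2 * s"
    and "\<And>p t1 t2. 1 \<le> p \<Longrightarrow> 0 < t1 \<Longrightarrow> t1 < t2 \<Longrightarrow>
           tendsto_Lp p (UNIV \<times> {t1..t2}) (\<lambda>l. rescale b u l) U at_top"
    and "weak_solution m s (scale_measure (ennreal M) (return borel 0)) U"
    and "\<beta> = 1 / ((m - 1) + 2 - 2 * s)" and "\<alpha> = \<beta>"
  shows "weak_solution m s (scale_measure (ennreal M) (return borel 0)) U \<and>
    (\<exists>\<phi> :: real \<Rightarrow> real. AE (x, t) in lborel. 0 < t \<longrightarrow>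
       U (x, t) = t powr (- \<alpha>) * \<phi> (x * t powr (- \<beta>)))"
proof
  show "weak_solution m s (scale_measure (ennreal M) (return borel 0)) U" by fact
  have "0 < b" and \<beta>: "\<beta> = 1 / b" "\<alpha> = 1 / b" using assms by auto
  have lim: "tendsto_Lp 1 (UNIV \<times> {t1..t2}) (\<lambda>l. rescale b u l) U at_top"
    if "0 < t1" "t1 < t2" for t1 t2
    using assms(9)[of 1] that by simp
  \<comment> \<open>Cutting off at t > 0 gives a function that is Borel on the whole plane. Scaling
    preserves the sign of t, so \<open>V\<close> may replace \<open>U\<close> on both sides of the
    invariance.\<close>
  define V where "V = (\<lambda>z. indicator (UNIV \<times> {0<..}) z * U z)"
  have V: "V (x, t) = U (x, t)" if "0 < t" for x t
    using that by (simp add: V_def)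
  have "V \<in> borel_measurable borel"
    unfolding V_def using lim
    by (intro borel_measurable_from_strips) (auto simp: tendsto_Lp_def in_Lp_def)
  moreover have "AE (x, t) in lborel. 0 < t \<longrightarrow> V (x, t) = k * V (k * x, k powr b * t)"
    if "0 < k" for k
  proof -
    have "AE (x, t) in lborel. 0 < t \<longrightarrow> U (x, t) = k * U (k * x, k powr b * t)"
      using lim that by (rule rescale_limit_invariant)
    then show ?thesis
      by eventually_elim (use that in \<open>auto simp: V\<close>)
  qed
  ultimately obtain \<phi> where "AE (x, t) in lborel. 0 < t \<longrightarrow>
      V (x, t) = t powr (- (1 / b)) * \<phi> (x * t powr (- (1 / b)))"
    using AE_scaling_invariant_imp_self_similar[OF _ \<open>0 < b\<close>] by blast
  then have "AE (x, t) in lborel. 0 < t \<longrightarrow>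
      U (x, t) = t powr (- \<alpha>) * \<phi> (x * t powr (- \<beta>))"
    unfolding \<beta> by eventually_elim (auto simp: V)
  then show "\<exists>\<phi> :: real \<Rightarrow> real. AE (x, t) in lborel. 0 < t \<longrightarrow>
      U (x, t) = t powr (- \<alpha>) * \<phi> (x * t powr (- \<beta>))"
    by blast
qed

end
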